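(* Let $d$ be a positive integer and let $p_{1},p_{2}\geq 2$ be integers. For $n\in\mathbb{N}$ let $A_{p_{1},p_{2}}(n)$, $B_{p_{1},p_{2}}(n)$ and $C_{p_{1},p_{2}}(n)$ be the partition counts defined in the context below. \begin{enumerate} \item If $p_{1}=2$ and $p_{2}$ is odd, then $A_{2,p_{2}}(n)\equiv B_{2,p_{2}}(n)\pmod{2}$ for all $n\in\mathbb{N}$. \item If $p_{1}$ is a prime with $p_{1}\geq 3$, $p_{2}\geq 2$ is an integer and $p_{1}\nmid p_{2}$, then for every integer $n\geq 1$, $$\sum_{i=0}^{n}A_{p_{1},p_{2}}(i)\,C_{p_{1},p_{2}}(n-i)\equiv 0\pmod{p_{1}}.$$ \end{enumerate}
   Context: Fix a positive integer $d$ and integers $p_{1},p_{2}\geq 2$ with $\gcd(p_{1},p_{2})=1$ (this holds under the hypotheses of each part). A partition of $n\in\mathbb{N}$ into parts from a set $S\subset\mathbb{N}_{+}$ is a representation $n=a_{1}+\dots+a_{k}$ with $a_{i}\in S$, order disregarded. $A_{p_{1},p_{2}}(n)$ is the number of partitions of $n$ into parts of the form $k^{d}$ where $k\geq 1$ is divisible neither by $p_{1}$ nor by $p_{2}$ (equivalently, $d$-th powers not divisible by $p_{1}^{d}$ nor by $p_{2}^{d}$); its generating function is $\sum_{n\ge0}A_{p_{1},p_{2}}(n)q^{n}=\prod_{n=1}^{\infty}\frac{(1-q^{(p_{1}n)^{d}})(1-q^{(p_{2}n)^{d}})}{(1-q^{n^{d}})(1-q^{(p_{1}p_{2}n)^{d}})}$.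 $B_{p_{1},p_{2}}(n)$ is the number of partitions of $n$ into distinct $d$-th powers not divisible by $p_{2}^{d}$, where each part carries one of $p_{1}^{d}-1$ colors (a given part with a given color appears at most once); its generating function is $\prod_{n=1}^{\infty}\left(\frac{1+q^{n^{d}}}{1+q^{(p_{2}n)^{d}}}\right)^{p_{1}^{d}-1}$. $C_{p_{1},p_{2}}(n)$ is the number of partitions of $n$ into $d$-th powers not divisible by $p_{2}^{d}$, where each part carries one of $p_{1}^{d}-1$ colors (repetitions allowed); its generating function is $\prod_{n=1}^{\infty}\left(\frac{1-q^{(p_{2}n)^{d}}}{1-q^{n^{d}}}\right)^{p_{1}^{d}-1}$. *)

theory Defs
  imports "HOL-Library.Multiset" "HOL-Number_Theory.Number_Theory"
begin

definition partitions :: "nat set \<Rightarrow> nat \<Rightarrow> nat multiset set" where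
  "partitions S n = {M. set_mset M \<subseteq> S \<and> sum_mset M = n}"

text \<open>A coloured part is a pair (part, colour), the colours being \<open>0, \<dots>, r - 1\<close>; two copies of
  a part with different colours are different coloured parts.\<close>

definition coloured_partitions :: "nat set \<Rightarrow> nat \<Rightarrow> nat \<Rightarrow> (nat \<times> nat) multiset set" where
  "coloured_partitions S r n =
     {M. set_mset M \<subseteq> S \<times> {..<r} \<and> sum_mset (image_mset fst M) = n}"

definition distinct_coloured_partitions ::
    "nat set \<Rightarrow> nat \<Rightarrow> nat \<Rightarrow> (nat \<times> nat) multiset set" where
  "distinct_coloured_partitions S r n =
     {M \<in> coloured_partitions S r n. \<forall>x. count M x \<le> 1}"

text \<open>The sets counted below are finite because all parts are positive (see
  \<open>finite_coloured_partitions\<close> and \<open>finite_partitions\<close> below), so \<open>card\<close> is the true count.\<close>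

definition part_A :: "nat \<Rightarrow> nat \<Rightarrow> nat \<Rightarrow> nat \<Rightarrow> nat" where
  "part_A d p1 p2 n =
     card (partitions {k ^ d | k. k \<ge> 1 \<and> \<not> p1 dvd k \<and> \<not> p2 dvd k} n)"

definition part_B :: "nat \<Rightarrow> nat \<Rightarrow> nat \<Rightarrow> nat \<Rightarrow> nat" where
  "part_B d p1 p2 n =
     card (distinct_coloured_partitions {k ^ d | k. k \<ge> 1 \<and> \<not> p2 ^ d dvd k ^ d} (p1 ^ d - 1) n)"

definition part_C :: "nat \<Rightarrow> nat \<Rightarrow> nat \<Rightarrow> nat \<Rightarrow> nat" where
  "part_C d p1 p2 n =
     card (coloured_partitions {k ^ d | k. k \<ge> 1 \<and> \<not> p2 ^ d dvd k ^ d} (p1 ^ d - 1) n)"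

lemma finite_coloured_partitions:
  assumes "0 \<notin> S"
  shows "finite (coloured_partitions S r n)"
proof (rule finite_subset)
  show "coloured_partitions S r n \<subseteq> (\<Union>m\<le>n. multisets_of_size ({..n} \<times> {..<r}) m)"
  proof
    fix M assume "M \<in> coloured_partitions S r n"
    then have M: "set_mset M \<subseteq> S \<times> {..<r}" and s: "sum_mset (image_mset fst M) = n"
      by (auto simp: coloured_partitions_def)
    have "size M = (\<Sum>x\<in>#M. 1)"
      by (rule size_eq_sum_mset)
    also have "\<dots> \<le> sum_mset (image_mset fst M)"
      using M assms by (intro sum_mset_mono) (auto simp: Suc_le_eq intro!: gr0I)
    finally have "size M \<le> n"
      using s by simp
    moreover have "fst x \<le> n" if "x \<in># M" for x
      using that s by (auto dest!: multi_member_split)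
    then have "set_mset M \<subseteq> {..n} \<times> {..<r}"
      using M by auto
    ultimately show "M \<in> (\<Union>m\<le>n. multisets_of_size ({..n} \<times> {..<r}) m)"
      by (auto simp: multisets_of_size_def)
  qed
qed (auto intro!: finite_multisets_of_size)

lemma finite_partitions:
  assumes "0 \<notin> S"
  shows "finite (partitions S n)"
proof -
  have "image_mset (\<lambda>k. (k, 0)) ` partitions S n \<subseteq> coloured_partitions S 1 n"
    by (auto simp: partitions_def coloured_partitions_def multiset.map_comp o_def)
  then have "finite (image_mset (\<lambda>k. (k, 0 :: nat)) ` partitions S n)"
    using finite_coloured_partitions[OF assms] by (rule finite_subset)
  moreover have "inj (image_mset (\<lambda>k :: nat. (k, 0 :: nat)))"
    by (intro multiset.inj_map injI) simp
  ultimately show ?thesis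
    by (rule finite_imageD[OF _ inj_on_subset[OF _ subset_UNIV]])
qed

end

theory Submission
  imports Defs "HOL-Computational_Algebra.Formal_Power_Series"
begin

text \<open>
  Let \<open>S\<close> be the set of \<open>d\<close>-th powers of the numbers not divisible by \<open>p2\<close>, let \<open>q = p1 ^ d\<close>, and let
  \<open>P\<close> be the product of the factors \<open>1 - X ^ s\<close> for \<open>s\<close> in \<open>S\<close>. As \<open>p1\<close> and \<open>p2\<close> are coprime,
  \<open>q \<cdot> S\<close> is contained in \<open>S\<close>, and the parts counted by \<open>A\<close> are those in \<open>S - q \<cdot> S\<close>. Modulo \<open>p1\<close>
  the product over \<open>q \<cdot> S\<close> is \<open>P ^ q\<close>, so the generating function of \<open>A\<close> is \<open>P ^ q / P = P ^ (q - 1)\<close>.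
  This is the inverse of the generating function of \<open>C\<close>, and modulo 2 it is that of \<open>B\<close>.
  Infinite products are avoided by calculating modulo a power of \<open>X\<close> as well.
\<close>

section \<open>Power series modulo an integer and a power of X\<close>

text \<open>Equality in the quotient of the integer power series ring by the ideal generated by
  \<open>m\<close> and \<open>X ^ N\<close>. Cutting off at \<open>X ^ N\<close> lets finite
  products stand for the infinite ones.\<close>

definition fps_cong :: "int \<Rightarrow> nat \<Rightarrow> int fps \<Rightarrow> int fps \<Rightarrow> bool" where
  "fps_cong m N F G \<longleftrightarrow> (\<forall>n<N. [fps_nth F n = fps_nth G n] (mod m))"

lemma fps_cong_refl [simp, intro]: "fps_cong m N F F"
  by (simp add: fps_cong_def)

lemma fps_cong_sym: "fps_cong m N F G \<Longrightarrow> fps_cong m N G F"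
  by (auto simp: fps_cong_def intro: cong_sym)

lemma fps_cong_trans [trans]: "fps_cong m N F G \<Longrightarrow> fps_cong m N G H \<Longrightarrow> fps_cong m N F H"
  by (auto simp: fps_cong_def intro: cong_trans)

lemma fps_cong_diff:
  "fps_cong m N F G \<Longrightarrow> fps_cong m N F' G' \<Longrightarrow> fps_cong m N (F - F') (G - G')"
  by (auto simp: fps_cong_def intro: cong_diff)

lemma fps_cong_mult:
  "fps_cong m N F G \<Longrightarrow> fps_cong m N F' G' \<Longrightarrow> fps_cong m N (F * F') (G * G')"
  by (auto simp: fps_cong_def fps_mult_nth intro!: cong_sum cong_mult)

lemma fps_cong_prod:
  assumes "\<And>x. x \<in> A \<Longrightarrow> fps_cong m N (f x) (g x)"
  shows "fps_cong m N (prod f A) (prod g A)"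
  using assms by (induction A rule: infinite_finite_induct) (auto intro!: fps_cong_mult)

lemma fps_cong_power: "fps_cong m N F G \<Longrightarrow> fps_cong m N (F ^ k) (G ^ k)"
  by (induction k) (auto intro!: fps_cong_mult)

lemma fps_cong_one_minus_X_power: "N \<le> s \<Longrightarrow> fps_cong m N (1 - fps_X ^ s) 1"
  by (auto simp: fps_cong_def)

section \<open>Prime powers of \<open>1 - Y\<close> modulo the prime\<close>

lemma fps_cong_one_minus_power_prime:
  fixes Y :: "int fps"
  assumes "prime p"
  shows "fps_cong (int p) N ((1 - Y) ^ p) (1 - Y ^ p)"
proof -
  define f where "f k = of_nat (p choose k) * Y ^ k * (1 - Y) ^ (p - k)" for k
  have "p > 0"
    using assms by (rule prime_gt_0_nat)
  \<comment> \<open>Expanding 1 instead of \<open>(1 - Y) ^ p\<close> avoids the sign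
    \<open>(-1) ^ p\<close>, so \<open>p = 2\<close> is no special case. The two extreme terms are
    the powers wanted; every other term has a binomial coefficient divisible by
    \<open>p\<close>.\<close>
  have "(1 :: int fps) = (Y + (1 - Y)) ^ p"
    by simp
  also have "\<dots> = (\<Sum>k\<le>p. f k)"
    by (simp only: binomial_ring f_def)
  also have "{..p} = insert 0 (insert p {0<..<p})"
    using \<open>p > 0\<close> by auto
  also have "sum f \<dots> = (1 - Y) ^ p + Y ^ p + sum f {0<..<p}"
    using \<open>p > 0\<close> by (simp add: f_def)
  finally have *: "(1 - Y) ^ p = 1 - Y ^ p - sum f {0<..<p}"
    by (simp add: algebra_simps)
  have "int p dvd fps_nth (f k) n" if "k \<in> {0<..<p}" for k n
  proof -
    have "p dvd p choose k"
      using that assms by (intro dvd_choose_prime) auto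
    then show ?thesis
      unfolding f_def mult.assoc by (simp add: fps_of_nat [symmetric])
  qed
  then have "fps_cong (int p) N (sum f {0<..<p}) 0"
    by (auto simp: fps_cong_def fps_sum_nth cong_0_iff intro!: dvd_sum)
  from fps_cong_diff [OF fps_cong_refl this, of "1 - Y ^ p"] show ?thesis
    by (simp add: *)
qed

lemma fps_cong_one_minus_power_prime_power:
  fixes Y :: "int fps"
  assumes "prime p"
  shows "fps_cong (int p) N ((1 - Y) ^ p ^ k) (1 - Y ^ p ^ k)"
proof (induction k)
  case (Suc k)
  have "fps_cong (int p) N (((1 - Y) ^ p ^ k) ^ p) ((1 - Y ^ p ^ k) ^ p)"
    using Suc by (rule fps_cong_power)
  \<comment> \<open>The prime case, applied to \<open>Y ^ p ^ k\<close> in place of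
    \<open>Y\<close>.\<close>
  also have "fps_cong (int p) N \<dots> (1 - (Y ^ p ^ k) ^ p)"
    using assms by (rule fps_cong_one_minus_power_prime)
  finally show ?case
    by (simp add: power_mult [symmetric] mult.commute)
qed simp

section \<open>Multisets of a given weight\<close>

text \<open>A general weight treats plain parts (\<open>w\<close> the identity) and coloured parts
  (\<open>w = fst\<close>) at once.\<close>

definition weighted_msets :: "('a \<Rightarrow> nat) \<Rightarrow> 'a set \<Rightarrow> nat \<Rightarrow> 'a multiset set" where
  "weighted_msets w S n = {M. set_mset M \<subseteq> S \<and> sum_mset (image_mset w M) = n}"

definition weighted_distinct_msets :: "('a \<Rightarrow> nat) \<Rightarrow> 'a set \<Rightarrow> nat \<Rightarrow> 'a multiset set" where
  "weighted_distinct_msets w S n = {M \<in> weighted_msets w S n. \<forall>x. count M x \<le> 1}"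

definition mset_gf :: "('a \<Rightarrow> nat) \<Rightarrow> 'a set \<Rightarrow> int fps" where
  "mset_gf w S = Abs_fps (\<lambda>n. int (card (weighted_msets w S n)))"

definition distinct_mset_gf :: "('a \<Rightarrow> nat) \<Rightarrow> 'a set \<Rightarrow> int fps" where
  "distinct_mset_gf w S = Abs_fps (\<lambda>n. int (card (weighted_distinct_msets w S n)))"

lemma weight_le_of_mem: "M \<in> weighted_msets w S n \<Longrightarrow> x \<in># M \<Longrightarrow> w x \<le> n"
  by (auto simp: weighted_msets_def dest!: multi_member_split)

text \<open>No element of a multiset weighs more than the whole. Coefficients below \<open>N\<close>
  are thus determined by the elements lighter than \<open>N\<close>, which will form a finite
  set.\<close>

lemma weighted_msets_truncate:
  "n < N \<Longrightarrow> weighted_msets w {x \<in> S. w x < N} n = weighted_msets w S n"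
  using weight_le_of_mem [of _ w S n] by (auto simp: weighted_msets_def subset_iff intro: le_less_trans)

lemma mset_gf_truncate: "fps_cong m N (mset_gf w S) (mset_gf w {x \<in> S. w x < N})"
  by (simp add: fps_cong_def mset_gf_def weighted_msets_truncate)

lemma distinct_mset_gf_truncate:
  "fps_cong m N (distinct_mset_gf w S) (distinct_mset_gf w {x \<in> S. w x < N})"
  by (simp add: fps_cong_def distinct_mset_gf_def weighted_distinct_msets_def weighted_msets_truncate)

section \<open>Finiteness, and the effect of adjoining one element\<close>

lemma finite_weighted_msets:
  assumes "finite T" and pos: "\<And>x. x \<in> T \<Longrightarrow> w x > 0"
  shows "finite (weighted_msets w T n)"
proof (rule finite_subset)
  show "weighted_msets w T n \<subseteq> (\<Union>m\<le>n. multisets_of_size T m)"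
  proof
    fix M assume M: "M \<in> weighted_msets w T n"
    have "size M = (\<Sum>x\<in>#M. 1)"
      by (rule size_eq_sum_mset)
    also have "\<dots> \<le> sum_mset (image_mset w M)"
      using M pos by (intro sum_mset_mono) (auto simp: weighted_msets_def Suc_le_eq)
    finally show "M \<in> (\<Union>m\<le>n. multisets_of_size T m)"
      using M by (auto simp: weighted_msets_def multisets_of_size_def)
  qed
qed (use assms in \<open>auto intro!: finite_multisets_of_size\<close>)

lemma finite_weighted_distinct_msets:
  "finite T \<Longrightarrow> (\<And>x. x \<in> T \<Longrightarrow> w x > 0) \<Longrightarrow> finite (weighted_distinct_msets w T n)"
  unfolding weighted_distinct_msets_def
  by (intro finite_Collect_conjI disjI1) (simp add: finite_weighted_msets)

text \<open>If \<open>x\<close> occurs, remove one copy. Further copies may remain, so the recursion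
  returns to \<open>insert x T\<close>; this is what produces a factor
  \<open>1 / (1 - X ^ w x)\<close>.\<close>

lemma weighted_msets_insert:
  "weighted_msets w (insert x T) n = weighted_msets w T n \<union>
     (if w x \<le> n then add_mset x ` weighted_msets w (insert x T) (n - w x) else {})"
  (is "?L = ?R")
proof (intro equalityI subsetI)
  fix M assume M: "M \<in> ?L"
  show "M \<in> ?R"
  proof (cases "x \<in># M")
    case True
    then obtain M' where [simp]: "M = add_mset x M'"
      by (auto dest: multi_member_split)
    have "w x \<le> n" and "M' \<in> weighted_msets w (insert x T) (n - w x)"
      using M by (auto simp: weighted_msets_def)
    then show ?thesis
      by simp
  qed (use M in \<open>auto simp: weighted_msets_def\<close>)
qed (auto simp: weighted_msets_def split: if_splits)

text \<open>Here removing \<open>x\<close> leaves no further copy, so the recursion falls back to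
  \<open>T\<close> and produces a factor \<open>1 + X ^ w x\<close>.\<close>

lemma weighted_distinct_msets_insert:
  assumes "x \<notin> T"
  shows "weighted_distinct_msets w (insert x T) n = weighted_distinct_msets w T n \<union>
     (if w x \<le> n then add_mset x ` weighted_distinct_msets w T (n - w x) else {})"
  (is "?L = ?R")
proof (intro equalityI subsetI)
  fix M assume M: "M \<in> ?L"
  show "M \<in> ?R"
  proof (cases "x \<in># M")
    case True
    then obtain M' where [simp]: "M = add_mset x M'"
      by (auto dest: multi_member_split)
    have c: "count (add_mset x M') y \<le> 1" for y
      using M by (simp add: weighted_distinct_msets_def)
    have "x \<notin># M'"
      using c [of x] by (simp add: not_in_iff)
    moreover have "count M' y \<le> 1" for y
      using c [of y] by (simp split: if_splits)
    ultimately have "w x \<le> n" and "M' \<in> weighted_distinct_msets w T (n - w x)"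
      using M by (auto simp: weighted_msets_def weighted_distinct_msets_def)
    then show ?thesis
      by simp
  qed (use M in \<open>auto simp: weighted_msets_def weighted_distinct_msets_def\<close>)
next
  fix M assume M: "M \<in> ?R"
  have "count M' x = 0" if "M' \<in> weighted_distinct_msets w T k" for M' k
    using that assms
    by (auto simp: weighted_distinct_msets_def weighted_msets_def count_eq_zero_iff)
  with M show "M \<in> ?L"
    by (auto simp: weighted_distinct_msets_def weighted_msets_def split: if_splits)
qed

text \<open>The two cases of the recursion are disjoint and \<open>add_mset x\<close> is injective,
  so cardinalities add up. Keeping the factor on the side of the larger set avoids inverses of power
  series.\<close>

lemma mset_gf_insert:
  assumes "finite T" "x \<notin> T" and "\<And>y. y \<in> insert x T \<Longrightarrow> w y > 0"
  shows "mset_gf w (insert x T) * (1 - fps_X ^ w x) = mset_gf w T"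
proof (rule fps_ext)
  fix n
  have fin: "finite (weighted_msets w (insert x T) k)" "finite (weighted_msets w T k)" for k
    using assms by (auto intro!: finite_weighted_msets)
  have not_in: "x \<notin># M" if "M \<in> weighted_msets w T n" for M
    using that \<open>x \<notin> T\<close> by (auto simp: weighted_msets_def)
  have "card (weighted_msets w (insert x T) n) = card (weighted_msets w T n) +
      (if w x \<le> n then card (weighted_msets w (insert x T) (n - w x)) else 0)"
  proof (cases "w x \<le> n")
    case True
    then have "weighted_msets w (insert x T) n =
        weighted_msets w T n \<union> add_mset x ` weighted_msets w (insert x T) (n - w x)"
      using weighted_msets_insert [of w x T n] by simp
    moreover have "weighted_msets w T n \<inter> add_mset x ` weighted_msets w (insert x T) (n - w x) = {}"
      by (auto dest: not_in)
    moreover have "inj_on (add_mset x) A" for A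
      by (simp add: inj_on_def)
    ultimately show ?thesis
      using fin True by (simp only: card_Un_disjoint card_image finite_imageI if_True)
  next
    case False
    then show ?thesis
      using weighted_msets_insert [of w x T n] by simp
  qed
  then show "fps_nth (mset_gf w (insert x T) * (1 - fps_X ^ w x)) n = fps_nth (mset_gf w T) n"
    by (simp add: mset_gf_def right_diff_distrib fps_X_power_mult_right_nth)
qed

lemma distinct_mset_gf_insert:
  assumes "finite T" "x \<notin> T" and "\<And>y. y \<in> insert x T \<Longrightarrow> w y > 0"
  shows "distinct_mset_gf w (insert x T) = distinct_mset_gf w T * (1 + fps_X ^ w x)"
proof (rule fps_ext)
  fix n
  have fin: "finite (weighted_distinct_msets w T k)" for k
    using assms by (auto intro!: finite_weighted_distinct_msets)
  have not_in: "x \<notin># M" if "M \<in> weighted_distinct_msets w T n" for M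
    using that \<open>x \<notin> T\<close> by (auto simp: weighted_distinct_msets_def weighted_msets_def)
  have "card (weighted_distinct_msets w (insert x T) n) = card (weighted_distinct_msets w T n) +
      (if w x \<le> n then card (weighted_distinct_msets w T (n - w x)) else 0)"
  proof (cases "w x \<le> n")
    case True
    then have "weighted_distinct_msets w (insert x T) n =
        weighted_distinct_msets w T n \<union> add_mset x ` weighted_distinct_msets w T (n - w x)"
      using weighted_distinct_msets_insert [OF \<open>x \<notin> T\<close>, of w n] by simp
    moreover have "weighted_distinct_msets w T n \<inter> add_mset x ` weighted_distinct_msets w T (n - w x) = {}"
      by (auto dest: not_in)
    moreover have "inj_on (add_mset x) A" for A
      by (simp add: inj_on_def)
    ultimately show ?thesis
      using fin True by (simp only: card_Un_disjoint card_image finite_imageI if_True)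
  next
    case False
    then show ?thesis
      using weighted_distinct_msets_insert [OF \<open>x \<notin> T\<close>, of w n] by simp
  qed
  then show "fps_nth (distinct_mset_gf w (insert x T)) n =
      fps_nth (distinct_mset_gf w T * (1 + fps_X ^ w x)) n"
    by (simp add: distinct_mset_gf_def distrib_left fps_X_power_mult_right_nth)
qed

section \<open>Product formulas over finite sets\<close>

lemma mset_gf_empty: "mset_gf w {} = 1"
proof (rule fps_ext)
  fix n
  have "weighted_msets w {} n = (if n = 0 then {{#}} else {})"
    by (auto simp: weighted_msets_def)
  then show "fps_nth (mset_gf w {}) n = fps_nth 1 n"
    by (simp add: mset_gf_def)
qed

lemma distinct_mset_gf_empty: "distinct_mset_gf w {} = 1"
proof (rule fps_ext)
  fix n
  have "weighted_distinct_msets w {} n = (if n = 0 then {{#}} else {})"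
    by (auto simp: weighted_distinct_msets_def weighted_msets_def)
  then show "fps_nth (distinct_mset_gf w {}) n = fps_nth 1 n"
    by (simp add: distinct_mset_gf_def)
qed

lemma mset_gf_mult_prod:
  assumes "finite T" and "\<And>x. x \<in> T \<Longrightarrow> w x > 0"
  shows "mset_gf w T * (\<Prod>x\<in>T. 1 - fps_X ^ w x) = 1"
  using assms
proof (induction T rule: finite_induct)
  case (insert x T)
  then have "mset_gf w (insert x T) * (1 - fps_X ^ w x) = mset_gf w T"
    by (intro mset_gf_insert) auto
  with insert show ?case
    by (simp add: mult.assoc [symmetric])
qed (simp add: mset_gf_empty)

lemma distinct_mset_gf_eq_prod:
  assumes "finite T" and "\<And>x. x \<in> T \<Longrightarrow> w x > 0"
  shows "distinct_mset_gf w T = (\<Prod>x\<in>T. 1 + fps_X ^ w x)"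
  using assms
proof (induction T rule: finite_induct)
  case (insert x T)
  then have "distinct_mset_gf w (insert x T) = distinct_mset_gf w T * (1 + fps_X ^ w x)"
    by (intro distinct_mset_gf_insert) auto
  with insert show ?case
    by (simp add: mult.commute)
qed (simp add: distinct_mset_gf_empty)

section \<open>Truncated Euler products\<close>

text \<open>The factors left out, those with \<open>s \<ge> N\<close>, are congruent to 1 modulo
  \<open>X ^ N\<close>.\<close>

definition euler_prod :: "nat \<Rightarrow> nat set \<Rightarrow> int fps" where
  "euler_prod N S = (\<Prod>s | s \<in> S \<and> s < N. 1 - fps_X ^ s)"

lemma mset_gf_mult_euler_prod:
  assumes "0 \<notin> S"
  shows "fps_cong m N (mset_gf (\<lambda>s. s) S * euler_prod N S) 1"
proof -
  have "mset_gf (\<lambda>s. s) {s \<in> S. s < N} * euler_prod N S = 1"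
    unfolding euler_prod_def using assms
    by (intro mset_gf_mult_prod) (auto intro!: gr0I)
  then show ?thesis
    using fps_cong_mult [OF mset_gf_truncate [of m N "\<lambda>s. s" S]
        fps_cong_refl [of m N "euler_prod N S"]]
    by simp
qed

lemma coloured_truncate:
  "{x \<in> S \<times> {..<r}. fst x < N} = {s \<in> S. s < N} \<times> {..<r :: nat}"
  by auto

lemma coloured_mset_gf_mult_euler_prod:
  assumes "0 \<notin> S"
  shows "fps_cong m N (mset_gf fst (S \<times> {..<r :: nat}) * euler_prod N S ^ r) 1"
proof -
  \<comment> \<open>Each part contributes its factor once for each of the \<open>r\<close>
    colours.\<close>
  have "euler_prod N S ^ r = (\<Prod>x\<in>{s \<in> S. s < N} \<times> {..<r}. 1 - fps_X ^ fst x)"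
    by (simp add: euler_prod_def prod.cartesian_product' prod_power_distrib)
  moreover have "mset_gf fst ({s \<in> S. s < N} \<times> {..<r}) * \<dots> = 1"
    using assms by (intro mset_gf_mult_prod) (auto intro!: gr0I)
  moreover have "fps_cong m N (mset_gf fst (S \<times> {..<r})) (mset_gf fst ({s \<in> S. s < N} \<times> {..<r}))"
    using mset_gf_truncate [of m N fst "S \<times> {..<r}"] by (simp only: coloured_truncate)
  ultimately show ?thesis
    using fps_cong_mult [OF _ fps_cong_refl [of m N "euler_prod N S ^ r"]] by fastforce
qed

text \<open>Modulo 2 the signs in the product formula for distinct parts do not matter, so it yields
  a power of the Euler product itself and not of its inverse.\<close>

lemma coloured_distinct_mset_gf_cong_euler_prod:
  assumes "0 \<notin> S"
  shows "fps_cong 2 N (distinct_mset_gf fst (S \<times> {..<r :: nat})) (euler_prod N S ^ r)"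
proof -
  have "fps_cong 2 N (distinct_mset_gf fst (S \<times> {..<r}))
      (distinct_mset_gf fst ({s \<in> S. s < N} \<times> {..<r}))"
    using distinct_mset_gf_truncate [of 2 N fst "S \<times> {..<r}"] by (simp only: coloured_truncate)
  also have "distinct_mset_gf fst ({s \<in> S. s < N} \<times> {..<r}) =
      (\<Prod>x\<in>{s \<in> S. s < N} \<times> {..<r}. 1 + fps_X ^ fst x)"
    using assms by (intro distinct_mset_gf_eq_prod) (auto intro!: gr0I)
  also have "fps_cong 2 N \<dots> (\<Prod>x\<in>{s \<in> S. s < N} \<times> {..<r}. 1 - fps_X ^ fst x)"
    by (intro fps_cong_prod) (auto simp: fps_cong_def cong_iff_dvd_diff)
  also have "\<dots> = euler_prod N S ^ r"
    by (simp add: euler_prod_def prod.cartesian_product' prod_power_distrib)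
  finally show ?thesis .
qed

text \<open>The congruence for \<open>(1 - Y) ^ p ^ k\<close> is applied to each factor, with
  \<open>Y = X ^ s\<close>. The remaining work is to match the truncations \<open>s < N\<close> and
  \<open>q * s < N\<close>.\<close>

lemma euler_prod_prime_power_multiples:
  assumes "prime p" and "q = p ^ k"
  shows "fps_cong (int p) N (euler_prod N S ^ q) (euler_prod N ((*) q ` S))"
proof -
  have "q > 0"
    using assms by (simp add: prime_gt_0_nat)
  have less: "s < N" if "q * s < N" for s
    using that \<open>q > 0\<close> by (cases q) auto
  define T where "T = {s. s \<in> S \<and> s < N}"
  have T': "{s. s \<in> (*) q ` S \<and> s < N} = (*) q ` {s \<in> T. q * s < N}"
    using less by (auto simp: T_def)
  have "euler_prod N S ^ q = (\<Prod>s\<in>T. (1 - fps_X ^ s) ^ q)"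
    by (simp add: euler_prod_def T_def prod_power_distrib)
  also have "fps_cong (int p) N \<dots> (\<Prod>s\<in>T. 1 - (fps_X ^ s) ^ q)"
    using assms by (auto intro!: fps_cong_prod fps_cong_one_minus_power_prime_power)
  also have "\<dots> = (\<Prod>s\<in>T. 1 - fps_X ^ (q * s))"
    by (simp add: power_mult [symmetric] mult.commute)
  \<comment> \<open>Factors with \<open>s < N \<le> q * s\<close> lie beyond the truncation of the
    right-hand product; they are 1 modulo \<open>X ^ N\<close>.\<close>
  also have "fps_cong (int p) N \<dots> (\<Prod>s\<in>T. if q * s < N then 1 - fps_X ^ (q * s) else 1)"
    by (intro fps_cong_prod) (auto simp: fps_cong_one_minus_X_power)
  also have "\<dots> = (\<Prod>s\<in>{s \<in> T. q * s < N}. 1 - fps_X ^ (q * s))"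
    by (rule prod.inter_filter [symmetric]) (simp add: T_def)
  also have "\<dots> = euler_prod N ((*) q ` S)"
    unfolding euler_prod_def T' using \<open>q > 0\<close> by (subst prod.reindex) (auto simp: inj_on_def)
  finally show ?thesis .
qed

text \<open>In the notation of the proof, \<open>?P = ?U * ?V\<close>, while \<open>?A * ?U\<close>
  and \<open>?F * ?P\<close> are congruent to 1 and \<open>?V\<close> to \<open>?P ^ q\<close>. So
  \<open>?A\<close> is the inverse of \<open>?U\<close>, that is \<open>?V / ?P\<close>, which is
  \<open>?P ^ (q - 1)\<close>.\<close>

lemma mset_gf_diff_multiples_cong:
  assumes "prime p" and q: "q = p ^ k" and "0 \<notin> S" and sub: "(*) q ` S \<subseteq> S"
  shows "fps_cong (int p) N (mset_gf (\<lambda>s. s) (S - (*) q ` S)) (euler_prod N S ^ (q - 1))"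
proof -
  let ?F = "mset_gf (\<lambda>s. s) S" and ?A = "mset_gf (\<lambda>s. s) (S - (*) q ` S)"
  let ?P = "euler_prod N S" and ?U = "euler_prod N (S - (*) q ` S)"
  let ?V = "euler_prod N ((*) q ` S)"
  have "q > 0"
    using assms by (simp add: prime_gt_0_nat)
  have UV: "?P = ?U * ?V"
    unfolding euler_prod_def using sub
    by (subst prod.union_disjoint [symmetric]) (auto intro!: prod.cong)
  have F: "fps_cong (int p) N (?F * ?P) 1"
    using assms by (intro mset_gf_mult_euler_prod)
  \<comment> \<open>Division by \<open>?P\<close> is carried out by multiplying with
    \<open>?F\<close>, its inverse in the quotient ring.\<close>
  have "fps_cong (int p) N ?A (?A * (?F * ?P))"
    using fps_cong_mult [OF fps_cong_refl F] by (auto intro: fps_cong_sym)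
  also have "?A * (?F * ?P) = (?A * ?U) * (?V * ?F)"
    by (simp add: UV mult_ac)
  also have "fps_cong (int p) N \<dots> (1 * (?P ^ q * ?F))"
    using assms
    by (intro fps_cong_mult mset_gf_mult_euler_prod fps_cong_refl
        fps_cong_sym [OF euler_prod_prime_power_multiples]) auto
  also have "1 * (?P ^ q * ?F) = ?P ^ (q - 1) * (?F * ?P)"
    using \<open>q > 0\<close> by (simp add: power_eq_if mult_ac)
  also have "fps_cong (int p) N \<dots> (?P ^ (q - 1) * 1)"
    by (intro fps_cong_mult fps_cong_refl F)
  finally show ?thesis
    by simp
qed

section \<open>Partitions into powers\<close>

text \<open>The set of parts for \<open>part_B\<close> and \<open>part_C\<close>. For
  \<open>d \<ge> 1\<close> the condition amounts to \<open>\<not> p dvd k\<close>.\<close>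

definition nondivisible_powers :: "nat \<Rightarrow> nat \<Rightarrow> nat set" where
  "nondivisible_powers d p = {k ^ d | k. k \<ge> 1 \<and> \<not> p ^ d dvd k ^ d}"

lemma zero_notin_nondivisible_powers: "0 \<notin> nondivisible_powers d p"
  by (auto simp: nondivisible_powers_def)

text \<open>\<open>p1 ^ d * k ^ d\<close> is the power of \<open>p1 * k\<close>, and by coprimality
  \<open>p2\<close> divides \<open>p1 * k\<close> only if it divides \<open>k\<close>.\<close>

lemma multiples_nondivisible_powers_subset:
  assumes "d \<ge> 1" "coprime p1 p2" "p1 > 0"
  shows "(*) (p1 ^ d) ` nondivisible_powers d p2 \<subseteq> nondivisible_powers d p2"
proof
  fix s assume "s \<in> (*) (p1 ^ d) ` nondivisible_powers d p2"
  then obtain k where k: "s = p1 ^ d * k ^ d" "k \<ge> 1" "\<not> p2 dvd k"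
    using assms by (auto simp: nondivisible_powers_def)
  have "\<not> p2 dvd p1 * k"
    using k assms by (simp add: coprime_dvd_mult_right_iff coprime_commute)
  then show "s \<in> nondivisible_powers d p2"
    using k assms by (auto simp: nondivisible_powers_def power_mult_distrib intro!: exI [of _ "p1 * k"])
qed

text \<open>If \<open>k = p1 * m\<close>, then \<open>m\<close> inherits non-divisibility by
  \<open>p2\<close>, so \<open>k ^ d\<close> is one of the removed multiples. Conversely
  \<open>p1 ^ d dvd k ^ d\<close> forces \<open>p1 dvd k\<close>, since
  \<open>d \<ge> 1\<close>.\<close>

lemma nondivisible_powers_diff_multiples:
  assumes "d \<ge> 1" "p1 > 0"
  shows "nondivisible_powers d p2 - (*) (p1 ^ d) ` nondivisible_powers d p2 =
    {k ^ d | k. k \<ge> 1 \<and> \<not> p1 dvd k \<and> \<not> p2 dvd k}"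
proof (intro equalityI subsetI)
  fix s assume s: "s \<in> nondivisible_powers d p2 - (*) (p1 ^ d) ` nondivisible_powers d p2"
  then obtain k where k: "s = k ^ d" "k \<ge> 1" "\<not> p2 dvd k"
    using assms by (auto simp: nondivisible_powers_def)
  have "\<not> p1 dvd k"
  proof
    assume "p1 dvd k"
    then obtain m where m: "k = p1 * m" ..
    with k assms have "m ^ d \<in> nondivisible_powers d p2"
      by (auto simp: nondivisible_powers_def)
    with s k m show False
      by (auto simp: power_mult_distrib)
  qed
  with k show "s \<in> {k ^ d | k. k \<ge> 1 \<and> \<not> p1 dvd k \<and> \<not> p2 dvd k}"
    by auto
next
  fix s assume "s \<in> {k ^ d | k. k \<ge> 1 \<and> \<not> p1 dvd k \<and> \<not> p2 dvd k}"
  then obtain k where k: "s = k ^ d" "k \<ge> 1" "\<not> p1 dvd k" "\<not> p2 dvd k"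
    by auto
  have "\<not> p1 ^ d dvd k ^ d"
    using k assms by simp
  then have "k ^ d \<noteq> p1 ^ d * m" for m
    by (metis dvd_triv_left)
  with k assms show "s \<in> nondivisible_powers d p2 - (*) (p1 ^ d) ` nondivisible_powers d p2"
    by (auto simp: nondivisible_powers_def)
qed

section \<open>The three counts as coefficients, and the congruences between them\<close>

lemma part_A_eq_nth:
  assumes "d \<ge> 1" "p1 > 0"
  shows "int (part_A d p1 p2 n) =
    fps_nth (mset_gf (\<lambda>s. s) (nondivisible_powers d p2 - (*) (p1 ^ d) ` nondivisible_powers d p2)) n"
  unfolding nondivisible_powers_diff_multiples [OF assms]
  by (simp add: part_A_def mset_gf_def weighted_msets_def partitions_def)

lemma part_B_eq_nth:
  "int (part_B d p1 p2 n) =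
    fps_nth (distinct_mset_gf fst (nondivisible_powers d p2 \<times> {..<p1 ^ d - 1})) n"
  by (simp add: part_B_def distinct_mset_gf_def weighted_distinct_msets_def weighted_msets_def
      distinct_coloured_partitions_def coloured_partitions_def nondivisible_powers_def)

lemma part_C_eq_nth:
  "int (part_C d p1 p2 n) = fps_nth (mset_gf fst (nondivisible_powers d p2 \<times> {..<p1 ^ d - 1})) n"
  by (simp add: part_C_def mset_gf_def weighted_msets_def coloured_partitions_def nondivisible_powers_def)

lemma part_A_gf_cong:
  assumes "d \<ge> 1" "prime p1" "\<not> p1 dvd p2"
  shows "fps_cong (int p1) N
    (mset_gf (\<lambda>s. s) (nondivisible_powers d p2 - (*) (p1 ^ d) ` nondivisible_powers d p2))
    (euler_prod N (nondivisible_powers d p2) ^ (p1 ^ d - 1))"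
  using assms
  by (intro mset_gf_diff_multiples_cong [where k = d] multiples_nondivisible_powers_subset
      zero_notin_nondivisible_powers) (auto simp: prime_imp_coprime prime_gt_0_nat)

theorem theorem2p1:
  fixes d p1 p2 :: nat
  assumes "d \<ge> 1" and "p1 \<ge> 2" and "p2 \<ge> 2"
  shows "(p1 = 2 \<and> odd p2 \<longrightarrow>
            (\<forall>n. [part_A d 2 p2 n = part_B d 2 p2 n] (mod 2))) \<and>
         (prime p1 \<and> p1 \<ge> 3 \<and> \<not> p1 dvd p2 \<longrightarrow>
            (\<forall>n\<ge>1. [(\<Sum>i=0..n. part_A d p1 p2 i * part_C d p1 p2 (n - i)) = 0] (mod p1)))"
proof (intro conjI impI allI)
  fix n assume "p1 = 2 \<and> odd p2"
  \<comment> \<open>The precision \<open>Suc n\<close> is the least that covers the coefficient of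
    \<open>X ^ n\<close>.\<close>
  then have "fps_cong 2 (Suc n)
      (mset_gf (\<lambda>s. s) (nondivisible_powers d p2 - (*) (2 ^ d) ` nondivisible_powers d p2))
      (euler_prod (Suc n) (nondivisible_powers d p2) ^ (2 ^ d - 1))"
    using assms part_A_gf_cong [of d 2 p2 "Suc n"] by simp
  also have "fps_cong 2 (Suc n) \<dots>
      (distinct_mset_gf fst (nondivisible_powers d p2 \<times> {..<2 ^ d - 1 :: nat}))"
    by (intro fps_cong_sym [OF coloured_distinct_mset_gf_cong_euler_prod] zero_notin_nondivisible_powers)
  finally have "[int (part_A d 2 p2 n) = int (part_B d 2 p2 n)] (mod 2)"
    using assms by (simp only: fps_cong_def part_A_eq_nth part_B_eq_nth)
  then show "[part_A d 2 p2 n = part_B d 2 p2 n] (mod 2)"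
    by (simp add: cong_int_iff [symmetric])
next
  fix n :: nat assume p1: "prime p1 \<and> p1 \<ge> 3 \<and> \<not> p1 dvd p2" and "n \<ge> 1"
  let ?S = "nondivisible_powers d p2" and ?r = "p1 ^ d - 1"
  let ?A = "mset_gf (\<lambda>s. s) (?S - (*) (p1 ^ d) ` ?S)" and ?C = "mset_gf fst (?S \<times> {..<?r})"
  have "fps_cong (int p1) (Suc n) (?A * ?C) (euler_prod (Suc n) ?S ^ ?r * ?C)"
    using assms p1 by (intro fps_cong_mult part_A_gf_cong fps_cong_refl) auto
  \<comment> \<open>The generating functions of \<open>A\<close> and \<open>C\<close> are inverse to
    each other modulo \<open>p1\<close>: one is the power \<open>?r\<close> of the Euler product,
    the other its inverse.\<close>
  also have "fps_cong (int p1) (Suc n) \<dots> 1"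
    using coloured_mset_gf_mult_euler_prod [OF zero_notin_nondivisible_powers] by (simp add: mult.commute)
  \<comment> \<open>Only the constant coefficient of the series 1 is nonzero, hence
    \<open>n \<ge> 1\<close>.\<close>
  finally have "[fps_nth (?A * ?C) n = 0] (mod int p1)"
    using \<open>n \<ge> 1\<close> by (auto simp: fps_cong_def dest: spec [of _ n])
  also have "fps_nth (?A * ?C) n = int (\<Sum>i=0..n. part_A d p1 p2 i * part_C d p1 p2 (n - i))"
    using assms by (simp add: fps_mult_nth part_A_eq_nth part_C_eq_nth)
  finally show "[(\<Sum>i=0..n. part_A d p1 p2 i * part_C d p1 p2 (n - i)) = 0] (mod p1)"
    by (simp add: cong_int_iff [symmetric])
qed

end
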